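(* Let $L$ be a bounded chain, let $n\geqslant 1$, and let $f\colon L^{n}\rightarrow L$ be a function. The following conditions are equivalent: (i) $f$ is a polynomial function. (ii) For any permutation $\sigma$ on $[n]$ and every $\mathbf{x}\in L^n_\sigma$, we have $$f(\mathbf{x})=\bigvee_{i\in[n+1]}\big(\alpha_f(S^{\uparrow}_\sigma(i))\wedge x_{\sigma(i)}\big)=\bigwedge_{i\in[n+1]}\big(\alpha_f(S^{\uparrow}_\sigma(i))\vee x_{\sigma(i-1)}\big)=\operatorname{med}\big(x_1,\ldots,x_n,\alpha_f(S^{\uparrow}_\sigma(1)),\ldots,\alpha_f(S^{\uparrow}_\sigma(n+1))\big),$$ where $x_{\sigma(0)}=0$ and $x_{\sigma(n+1)}=1$. (iii) For any permutation $\sigma$ on $[n]$ and every $\mathbf{x}\in L^n_\sigma$, we have $$f(\mathbf{x})=\bigvee_{i\in[n+1]}\big(\beta_f(S^{\downarrow}_\sigma(i-1))\wedge x_{\sigma(i)}\big)=\bigwedge_{i\in[n+1]}\big(\beta_f(S^{\downarrow}_\sigma(i-1))\vee x_{\sigma(i-1)}\big)=\operatorname{med}\big(x_1,\ldots,x_n,\beta_f(S^{\downarrow}_\sigma(0)),\ldots,\beta_f(S^{\downarrow}_\sigma(n))\big),$$ where $x_{\sigma(0)}=0$ and $x_{\sigma(n+1)}=1$.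
   Context: A bounded chain is a totally ordered set $L$ with least element $0$ and greatest element $1$, viewed as a lattice with $\wedge=\min$, $\vee=\max$. $[m]=\{1,\ldots,m\}$. A polynomial function $L^n\to L$ is any function obtained by finitely many applications of: (i) for each $i\in[n]$ and $c\in L$, the projection $\mathbf{x}\mapsto x_i$ and the constant function $\mathbf{x}\mapsto c$ are polynomial functions; (ii) if $f,g$ are polynomial functions then so are $f\vee g$ and $f\wedge g$ (pointwise). For $I\subseteq[n]$, $\mathbf{e}_I\in L^n$ has $i$th component $1$ if $i\in I$ and $0$ otherwise. For $f\colon L^n\to L$, define $\alpha_f,\beta_f\colon 2^{[n]}\to L$ by $\alpha_f(I)=f(\mathbf{e}_I)$ and $\beta_f(I)=f(\mathbf{e}_{[n]\setminus I})$. For a permutation $\sigma$ on $[n]$, $L^n_\sigma=\{\mathbf{x}\in L^n: x_{\sigma(1)}\leqslant x_{\sigma(2)}\leqslant\cdots\leqslant x_{\sigma(n)}\}$; for $i\in[n]$, $S^{\uparrow}_\sigma(i)=\{\sigma(i),\ldots,\sigma(n)\}$ and $S^{\downarrow}_\sigma(i)=\{\sigma(1),\ldots,\sigma(i)\}$; and $S^{\uparrow}_\sigma(n+1)=S^{\downarrow}_\sigma(0)=\varnothing$. The median of $2m+1$ elements is $\operatorname{med}(y_1,\ldots,y_{2m+1})=\bigvee_{I\subseteq[2m+1],\,|I|=m+1}\bigwedge_{i\in I}y_i$. *)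

theory Defs
  imports Main "HOL-Library.FuncSet" "HOL-Combinatorics.Permutations"
begin

text \<open>
  A bounded chain is a type of sort \<open>{linorder, order_bot, order_top}\<close>; its lattice
  operations are \<open>min\<close> and \<open>max\<close>, and finite nonempty meets and joins are \<open>Min\<close> and \<open>Max\<close>.
  The one-element chain is not excluded.

  An element of \<open>L\<close> to the power \<open>n\<close> is an extensional function on \<open>{1..n}\<close>, and an
  \<open>n\<close>-ary function is an extensional function on the set of those, so that equality of
  HOL functions is equality of \<open>n\<close>-ary functions.
\<close>

definition chain_power :: "nat \<Rightarrow> (nat \<Rightarrow> 'a) set" where
  "chain_power n = {1..n} \<rightarrow>\<^sub>E UNIV"

inductive polynomial_function ::
  "nat \<Rightarrow> ((nat \<Rightarrow> 'a::{linorder, order_bot, order_top}) \<Rightarrow> 'a) \<Rightarrow> bool"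
  for n :: nat where
  proj: "i \<in> {1..n} \<Longrightarrow> polynomial_function n (\<lambda>x\<in>chain_power n. x i)"
| const: "polynomial_function n (\<lambda>x\<in>chain_power n. c)"
| join: "polynomial_function n f \<Longrightarrow> polynomial_function n g \<Longrightarrow>
    polynomial_function n (\<lambda>x\<in>chain_power n. max (f x) (g x))"
| meet: "polynomial_function n f \<Longrightarrow> polynomial_function n g \<Longrightarrow>
    polynomial_function n (\<lambda>x\<in>chain_power n. min (f x) (g x))"

definition char_vec :: "nat \<Rightarrow> nat set \<Rightarrow> nat \<Rightarrow> 'a::{linorder, order_bot, order_top}" where
  "char_vec n I = (\<lambda>i\<in>{1..n}. if i \<in> I then top else bot)"

definition alpha ::
  "nat \<Rightarrow> ((nat \<Rightarrow> 'a::{linorder, order_bot, order_top}) \<Rightarrow> 'a) \<Rightarrow> nat set \<Rightarrow> 'a" where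
  "alpha n f I = f (char_vec n I)"

definition beta ::
  "nat \<Rightarrow> ((nat \<Rightarrow> 'a::{linorder, order_bot, order_top}) \<Rightarrow> 'a) \<Rightarrow> nat set \<Rightarrow> 'a" where
  "beta n f I = f (char_vec n ({1..n} - I))"

definition chain_simplex ::
  "nat \<Rightarrow> (nat \<Rightarrow> nat) \<Rightarrow> (nat \<Rightarrow> 'a::{linorder, order_bot, order_top}) set" where
  "chain_simplex n \<sigma> =
    {x \<in> chain_power n. \<forall>i\<in>{1..<n}. x (\<sigma> i) \<le> x (\<sigma> (Suc i))}"

text \<open>\<open>S_up n \<sigma> (n + 1)\<close> and \<open>S_down \<sigma> 0\<close> are empty because the intervals are.\<close>

definition S_up :: "nat \<Rightarrow> (nat \<Rightarrow> nat) \<Rightarrow> nat \<Rightarrow> nat set" where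
  "S_up n \<sigma> i = \<sigma> ` {i..n}"

definition S_down :: "(nat \<Rightarrow> nat) \<Rightarrow> nat \<Rightarrow> nat set" where
  "S_down \<sigma> i = \<sigma> ` {1..i}"

text \<open>
  \<open>ord_comp n \<sigma> x i\<close> is the component of \<open>x\<close> at \<open>\<sigma> i\<close>, with the boundary conventions
  \<open>bot\<close> at \<open>i = 0\<close> and \<open>top\<close> at \<open>i = n + 1\<close>.
\<close>

definition ord_comp ::
  "nat \<Rightarrow> (nat \<Rightarrow> nat) \<Rightarrow> (nat \<Rightarrow> 'a::{linorder, order_bot, order_top}) \<Rightarrow> nat \<Rightarrow> 'a" where
  "ord_comp n \<sigma> x i = (if i = 0 then bot else if i = n + 1 then top else x (\<sigma> i))"

text \<open>
  The median is only meant for lists of odd length \<open>2 * m + 1\<close>, where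
  \<open>length ys div 2 + 1 = m + 1\<close>. Positions are counted from 0.
\<close>

definition med :: "'a::linorder list \<Rightarrow> 'a" where
  "med ys = (MAX I\<in>{I. I \<subseteq> {..<length ys} \<and> card I = length ys div 2 + 1}. MIN i\<in>I. ys ! i)"

end

theory Submission
  imports Defs
begin

text \<open>
  Write \<open>t i\<close> for the \<open>i\<close>-th smallest component of a point \<open>x\<close> (with \<open>t 0 = bot\<close> and
  \<open>t (n + 1) = top\<close>) and \<open>a i\<close> for the value of \<open>f\<close> at the \<open>0\<close>-\<open>1\<close> vector that is \<open>1\<close> exactly at
  the positions \<open>\<sigma> i, \<dots>, \<sigma> n\<close>, those carrying the components from \<open>t i\<close> upwards. The whole proof
  turns on the inequalities \<open>min (a i) (t i) \<le> y \<le> max (a i) (t (i - 1))\<close> for all \<open>i\<close>.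

  At most one \<open>y\<close> satisfies all of them, because at the first index with \<open>a i \<le> t i\<close> the upper
  bound is met by the lower bounds at that index and its predecessor (\<open>squeeze_unique\<close>). When
  \<open>a\<close> is decreasing, the join of the lower bounds, the meet of the upper bounds and the median
  all satisfy them (\<open>squeeze_values\<close>), the median because \<open>n + 1\<close> of its \<open>2 n + 1\<close> entries lie
  above each lower bound and \<open>n + 1\<close> lie below each upper bound. A polynomial function satisfies
  them too: its value at \<open>x\<close> is compared with its value at a \<open>0\<close>-\<open>1\<close> vector by a structural
  induction in which the threshold stays fixed (\<open>polynomial_function_ge_threshold\<close>,
  \<open>polynomial_function_le_threshold\<close>). So the three expressions equal \<open>f x\<close>.

  Conversely, the formula as a join, read at the vectors \<open>char_vec n J\<close>, already forces
  \<open>alpha n f\<close> to be monotone (\<open>alpha_mono_if_join_formula\<close>). Monotonicity turns the join over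
  the \<open>n + 1\<close> sets attached to an ordering of the components into a join over all subsets of
  \<open>{1..n}\<close>, independent of the ordering, and this disjunctive normal form is a polynomial
  (\<open>polynomial_function_if_join_formula\<close>).

  The version with \<open>beta\<close> is a rewriting of the one with \<open>alpha\<close>, since the last \<open>n - i + 1\<close>
  values of a permutation are the complement of the first \<open>i - 1\<close>.
\<close>

section \<open>Medians in a chain\<close>

lemma med_ge:
  assumes "I \<subseteq> {..<length ys}" "card I = length ys div 2 + 1" "\<And>i. i \<in> I \<Longrightarrow> v \<le> ys ! i"
  shows "v \<le> med ys"
proof -
  let ?F = "{I. I \<subseteq> {..<length ys} \<and> card I = length ys div 2 + 1}"
  have "finite I" "I \<noteq> {}"
    using assms(1,2) finite_subset by auto
  then have "v \<le> (MIN i\<in>I. ys ! i)"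
    using assms(3) by simp
  also have "\<dots> \<le> (MAX I\<in>?F. MIN i\<in>I. ys ! i)"
    using assms(1,2) by (intro Max_ge) auto
  finally show ?thesis
    by (simp add: med_def)
qed

text \<open>Two sets of more than half of the positions meet.\<close>

lemma med_le:
  assumes "J \<subseteq> {..<length ys}" "card J = length ys div 2 + 1" "\<And>i. i \<in> J \<Longrightarrow> ys ! i \<le> v"
  shows "med ys \<le> v"
proof -
  let ?F = "{I. I \<subseteq> {..<length ys} \<and> card I = length ys div 2 + 1}"
  have "(MIN i\<in>I. ys ! i) \<le> v" if I: "I \<in> ?F" for I
  proof -
    have fin: "finite I" "finite J"
      using I assms(1) finite_subset by auto
    have "I \<inter> J \<noteq> {}"
    proof
      assume "I \<inter> J = {}"
      then have "card I + card J = card (I \<union> J)"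
        using fin by (simp add: card_Un_disjoint)
      also have "\<dots> \<le> length ys"
        using I assms(1) card_mono[of "{..<length ys}" "I \<union> J"] by auto
      finally show False
        using I assms(2) by auto
    qed
    then obtain i where i: "i \<in> I" "i \<in> J"
      by auto
    then have "(MIN i\<in>I. ys ! i) \<le> ys ! i"
      using fin by (intro Min_le) auto
    also have "\<dots> \<le> v"
      using i assms(3) by auto
    finally show ?thesis .
  qed
  moreover have "J \<in> ?F"
    using assms by auto
  ultimately show ?thesis
    unfolding med_def by (subst Max_le_iff) auto
qed

section \<open>Values squeezed between a decreasing and an increasing sequence\<close>

text \<open>
  For decreasing \<open>a\<close> and increasing \<open>t\<close> with \<open>t 0 = bot\<close> and \<open>t N = top\<close>, this says that \<open>y\<close>
  is the height at which the two sequences cross.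
\<close>

definition squeezed ::
  "nat \<Rightarrow> (nat \<Rightarrow> 'a::linorder) \<Rightarrow> (nat \<Rightarrow> 'a) \<Rightarrow> 'a \<Rightarrow> bool" where
  "squeezed N a t y \<longleftrightarrow> (\<forall>i\<in>{1..N}. min (a i) (t i) \<le> y \<and> y \<le> max (a i) (t (i - 1)))"

text \<open>
  Let \<open>k\<close> be the first index with \<open>a k \<le> t k\<close>. The lower bounds at \<open>k\<close> and \<open>k - 1\<close> are then \<open>a k\<close>
  and \<open>t (k - 1)\<close>, and the upper bound at \<open>k\<close> is their maximum, so all \<open>y\<close> have this value. The
  conditions on \<open>t\<close> at the ends make \<open>k\<close> exist and cover the case \<open>k = 1\<close>.
\<close>

lemma squeeze_unique:
  fixes a t :: "nat \<Rightarrow> 'a::{linorder, order_bot, order_top}"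
  assumes "N \<ge> 1" "t 0 = bot" "t N = top"
    and y: "squeezed N a t y" and z: "squeezed N a t z"
  shows "y = z"
proof -
  let ?P = "\<lambda>i. 1 \<le> i \<and> a i \<le> t i"
  define k where "k = (LEAST i. ?P i)"
  have "?P N"
    using assms by auto
  then have k: "?P k" "k \<le> N"
    unfolding k_def by (rule LeastI, rule Least_le)
  have prev: "t (k - 1) \<le> a (k - 1)" if "k > 1"
    using not_less_Least[of "k - 1" ?P] that unfolding k_def[symmetric] by auto
  have "w = max (a k) (t (k - 1))" if w: "squeezed N a t w" for w
  proof (rule antisym)
    show "w \<le> max (a k) (t (k - 1))"
      using w k unfolding squeezed_def by auto
    have "a k \<le> w"
      using w k unfolding squeezed_def by (metis atLeastAtMost_iff min.absorb1)
    moreover have "t (k - 1) \<le> w"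
    proof (cases "k = 1")
      case True
      then show ?thesis
        using assms by simp
    next
      case False
      then have "k - 1 \<in> {1..N}" "k > 1"
        using k by auto
      then show ?thesis
        using w prev unfolding squeezed_def by (metis min.absorb2)
    qed
    ultimately show "max (a k) (t (k - 1)) \<le> w"
      by simp
  qed
  then show ?thesis
    using y z by metis
qed

text \<open>
  Every lower bound is below every upper bound: going to a smaller or equal index increases \<open>a\<close>,
  going to a larger index increases \<open>t (i - 1)\<close> at least to \<open>t\<close> at the old index.
\<close>

lemma squeezed_Max_Min:
  fixes a t :: "nat \<Rightarrow> 'a::linorder"
  assumes "N \<ge> 1"
    and a: "\<And>i j. 1 \<le> i \<Longrightarrow> i \<le> j \<Longrightarrow> j \<le> N \<Longrightarrow> a j \<le> a i"
    and t: "\<And>i j. i \<le> j \<Longrightarrow> j \<le> N \<Longrightarrow> t i \<le> t j"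
  shows "squeezed N a t (MAX i\<in>{1..N}. min (a i) (t i))"
    and "squeezed N a t (MIN i\<in>{1..N}. max (a i) (t (i - 1)))"
proof -
  have le: "min (a i) (t i) \<le> max (a j) (t (j - 1))" if "i \<in> {1..N}" "j \<in> {1..N}" for i j
  proof (cases "j \<le> i")
    case True
    then have "a i \<le> a j"
      using that a by auto
    then show ?thesis
      by (simp add: min.coboundedI1 max.coboundedI1)
  next
    case False
    then have "t i \<le> t (j - 1)"
      using that t by auto
    then show ?thesis
      by (simp add: min.coboundedI2 max.coboundedI2)
  qed
  have ne: "{1..N} \<noteq> {}"
    using \<open>N \<ge> 1\<close> by auto
  show "squeezed N a t (MAX i\<in>{1..N}. min (a i) (t i))"
    unfolding squeezed_def
  proof (intro ballI conjI)
    fix i assume i: "i \<in> {1..N}"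
    show "min (a i) (t i) \<le> (MAX i\<in>{1..N}. min (a i) (t i))"
      using i by (intro Max_ge finite_imageI imageI) auto
    show "(MAX i\<in>{1..N}. min (a i) (t i)) \<le> max (a i) (t (i - 1))"
      using le i ne by (intro Max.boundedI) auto
  qed
  show "squeezed N a t (MIN i\<in>{1..N}. max (a i) (t (i - 1)))"
    unfolding squeezed_def
  proof (intro ballI conjI)
    fix i assume i: "i \<in> {1..N}"
    show "(MIN i\<in>{1..N}. max (a i) (t (i - 1))) \<le> max (a i) (t (i - 1))"
      using i by (intro Min_le finite_imageI) auto
    show "min (a i) (t i) \<le> (MIN i\<in>{1..N}. max (a i) (t (i - 1)))"
      using le i ne by (intro Min.boundedI) auto
  qed
qed

section \<open>Permutations and sorted components\<close>

lemma sorting_permutation: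
  fixes key :: "nat \<Rightarrow> 'b::linorder"
  obtains \<sigma> where "\<sigma> permutes {1..n}"
    "\<And>i j. 1 \<le> i \<Longrightarrow> i \<le> j \<Longrightarrow> j \<le> n \<Longrightarrow> key (\<sigma> i) \<le> key (\<sigma> j)"
proof -
  define l where "l = sort_key key [1..<n+1]"
  have l: "length l = n" "distinct l" "set l = {1..n}" "sorted (map key l)"
    by (auto simp: l_def)
  define \<sigma> where "\<sigma> i = (if i \<in> {1..n} then l ! (i - 1) else i)" for i
  have "bij_betw (\<lambda>i. l ! (i - 1)) {1..n} {1..n}"
  proof -
    have "bij_betw ((!) l) {..<n} {1..n}"
      using l by (intro bij_betw_nth) auto
    moreover have "bij_betw (\<lambda>i. i - 1) {1..n} {..<n}"
      by (rule bij_betw_byWitness[where f' = Suc]) auto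
    ultimately show ?thesis
      using bij_betw_trans[of "\<lambda>i. i - 1" _ _ "(!) l"] by (simp add: comp_def)
  qed
  then have "bij_betw \<sigma> {1..n} {1..n}"
    using bij_betw_cong[of "{1..n}" \<sigma> "\<lambda>i. l ! (i - 1)" "{1..n}"] by (simp add: \<sigma>_def)
  then have "\<sigma> permutes {1..n}"
    by (rule bij_imp_permutes) (auto simp: \<sigma>_def)
  moreover have "key (\<sigma> i) \<le> key (\<sigma> j)" if "1 \<le> i" "i \<le> j" "j \<le> n" for i j
    using that l sorted_nth_mono[of "map key l" "i - 1" "j - 1"] by (simp add: \<sigma>_def)
  ultimately show ?thesis
    using that by blast
qed

lemma chain_simplex_mono:
  assumes "x \<in> chain_simplex n \<sigma>" "1 \<le> i" "i \<le> j" "j \<le> n"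
  shows "x (\<sigma> i) \<le> x (\<sigma> j)"
  using assms(3,4)
proof (induction j rule: dec_induct)
  case (step m)
  then have "x (\<sigma> m) \<le> x (\<sigma> (Suc m))"
    using assms by (auto simp: chain_simplex_def)
  then show ?case
    using step by auto
qed simp

lemma ord_comp_mono:
  assumes "x \<in> chain_simplex n \<sigma>" "i \<le> j" "j \<le> n + 1"
  shows "ord_comp n \<sigma> x i \<le> ord_comp n \<sigma> x j"
  using assms chain_simplex_mono[of x n \<sigma> i j] by (auto simp: ord_comp_def)

lemma S_up_subset: "\<sigma> permutes {1..n} \<Longrightarrow> 1 \<le> i \<Longrightarrow> S_up n \<sigma> i \<subseteq> {1..n}"
  using permutes_image[of \<sigma> "{1..n}"] by (auto simp: S_up_def)

lemma S_up_eq_Diff_S_down: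
  assumes "\<sigma> permutes {1..n}" "1 \<le> i" "i \<le> n + 1"
  shows "{1..n} - S_down \<sigma> (i - 1) = S_up n \<sigma> i"
proof -
  have "{1..n} - S_down \<sigma> (i - 1) = \<sigma> ` {1..n} - \<sigma> ` {1..i - 1}"
    using assms by (simp only: S_down_def permutes_image)
  also have "\<dots> = \<sigma> ` ({1..n} - {1..i - 1})"
    using permutes_inj[OF assms(1)] by (simp add: image_set_diff)
  also have "{1..n} - {1..i - 1} = {i..n}"
    using assms by auto
  finally show ?thesis
    by (simp add: S_up_def)
qed

text \<open>
  \<open>S_up n \<sigma> i\<close> is the smallest of the sets \<open>S_up n \<sigma> j\<close> that contains \<open>I\<close>; for empty \<open>I\<close> the
  index is \<open>n + 1\<close>.
\<close>

lemma first_index_in_set: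
  assumes "\<sigma> permutes {1..n}" "I \<subseteq> {1..n}"
  obtains i where "1 \<le> i" "i \<le> n + 1" "I \<subseteq> S_up n \<sigma> i" "i = n + 1 \<or> \<sigma> i \<in> I"
proof -
  let ?P = "\<lambda>i. 1 \<le> i \<and> (i = n + 1 \<or> \<sigma> i \<in> I)"
  define i where "i = (LEAST i. ?P i)"
  have "?P (n + 1)"
    by simp
  then have i: "?P i" "i \<le> n + 1"
    unfolding i_def by (rule LeastI, rule Least_le)
  have "I \<subseteq> S_up n \<sigma> i"
  proof
    fix p assume p: "p \<in> I"
    then obtain j where j: "j \<in> {1..n}" "p = \<sigma> j"
      using assms permutes_image[OF assms(1)] by blast
    then have "i \<le> j"
      unfolding i_def using p by (intro Least_le) auto
    then show "p \<in> S_up n \<sigma> i"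
      using j by (auto simp: S_up_def)
  qed
  then show ?thesis
    using i that by blast
qed

text \<open>
  The list entries are \<open>x 1, \<dots>, x n, a 1, \<dots>, a (n + 1)\<close>. The entries \<open>x (\<sigma> i), \<dots>, x (\<sigma> n)\<close> and
  \<open>a 1, \<dots>, a i\<close> lie above the lower bound with index \<open>i\<close>, and the entries \<open>x (\<sigma> 1), \<dots>,
  x (\<sigma> (i - 1))\<close> and \<open>a i, \<dots>, a (n + 1)\<close> lie below the upper bound: \<open>n + 1\<close> entries in each case.
\<close>

lemma squeezed_med:
  fixes x :: "nat \<Rightarrow> 'a::{linorder, order_bot, order_top}"
  assumes \<sigma>: "\<sigma> permutes {1..n}" and x: "x \<in> chain_simplex n \<sigma>"
    and a: "\<And>i j. 1 \<le> i \<Longrightarrow> i \<le> j \<Longrightarrow> j \<le> n + 1 \<Longrightarrow> a j \<le> a i"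
  shows "squeezed (n + 1) a (ord_comp n \<sigma> x) (med (map x [1..<n+1] @ map a [1..<n+2]))"
    (is "squeezed _ _ _ (med ?ys)")
  unfolding squeezed_def
proof (intro ballI conjI)
  fix i assume i: "i \<in> {1..n + 1}"
  have len: "length ?ys = 2 * n + 1" "length ?ys div 2 + 1 = n + 1"
    by auto
  have range: "\<sigma> j \<in> {1..n}" if "j \<in> {1..n}" for j
    using permutes_in_image[OF \<sigma>] that by blast
  have nth_x: "?ys ! (\<sigma> j - 1) = x (\<sigma> j)" if "j \<in> {1..n}" for j
    using range[OF that] by (auto simp: nth_append simp del: upt_Suc)
  have nth_a: "?ys ! p = a (p - n + 1)" if "p \<in> {n..<2 * n + 1}" for p
    using that by (auto simp: nth_append simp del: upt_Suc)
  have card_pos: "card ((\<lambda>j. \<sigma> j - 1) ` B \<union> C) = card B + card C"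
    if "B \<subseteq> {1..n}" "C \<subseteq> {n..<2 * n + 1}" for B C
  proof -
    have "inj_on (\<lambda>j. \<sigma> j - 1) B"
    proof (rule inj_onI)
      fix j k assume jk: "j \<in> B" "k \<in> B" "\<sigma> j - 1 = \<sigma> k - 1"
      then have "\<sigma> j \<in> {1..n}" "\<sigma> k \<in> {1..n}"
        using range that(1) by blast+
      then have "\<sigma> j = \<sigma> k"
        using jk(3) by auto
      then show "j = k"
        using permutes_inj[OF \<sigma>] by (simp add: inj_def)
    qed
    then have "card ((\<lambda>j. \<sigma> j - 1) ` B) = card B"
      by (rule card_image)
    moreover have "(\<lambda>j. \<sigma> j - 1) ` B \<inter> C = {}"
      using range that by fastforce
    moreover have "finite B" "finite C"
      using that finite_subset by blast+
    ultimately show ?thesis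
      by (simp add: card_Un_disjoint)
  qed
  have pos: "(\<lambda>j. \<sigma> j - 1) ` B \<union> C \<subseteq> {..<length ?ys}"
    if "B \<subseteq> {1..n}" "C \<subseteq> {n..<2 * n + 1}" for B C
    using range that unfolding len by fastforce
  show "min (a i) (ord_comp n \<sigma> x i) \<le> med ?ys"
  proof (rule med_ge)
    let ?I = "(\<lambda>j. \<sigma> j - 1) ` {i..n} \<union> {n..<n + i}"
    have sub: "{i..n} \<subseteq> {1..n}" "{n..<n + i} \<subseteq> {n..<2 * n + 1}"
      using i by auto
    show "?I \<subseteq> {..<length ?ys}"
      by (rule pos[OF sub])
    show "card ?I = length ?ys div 2 + 1"
      unfolding card_pos[OF sub] len using i by simp
    fix p assume "p \<in> ?I"
    then consider j where "j \<in> {i..n}" "p = \<sigma> j - 1" | "p \<in> {n..<n + i}"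
      by blast
    then show "min (a i) (ord_comp n \<sigma> x i) \<le> ?ys ! p"
    proof cases
      case 1
      then have "j \<in> {1..n}" "ord_comp n \<sigma> x i \<le> x (\<sigma> j)"
        using i ord_comp_mono[OF x, of i j] by (auto simp: ord_comp_def)
      then show ?thesis
        using 1 nth_x by (simp add: min.coboundedI2)
    next
      case 2
      then have "a i \<le> a (p - n + 1)"
        using i by (intro a) auto
      moreover have "?ys ! p = a (p - n + 1)"
        using 2 sub(2) by (intro nth_a) blast
      ultimately show ?thesis
        by (metis min.coboundedI1)
    qed
  qed
  show "med ?ys \<le> max (a i) (ord_comp n \<sigma> x (i - 1))"
  proof (rule med_le)
    let ?I = "(\<lambda>j. \<sigma> j - 1) ` {1..i - 1} \<union> {n + i - 1..<2 * n + 1}"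
    have sub: "{1..i - 1} \<subseteq> {1..n}" "{n + i - 1..<2 * n + 1} \<subseteq> {n..<2 * n + 1}"
      using i by auto
    show "?I \<subseteq> {..<length ?ys}"
      by (rule pos[OF sub])
    show "card ?I = length ?ys div 2 + 1"
      unfolding card_pos[OF sub] len using i by auto
    fix p assume "p \<in> ?I"
    then consider j where "j \<in> {1..i - 1}" "p = \<sigma> j - 1" | "p \<in> {n + i - 1..<2 * n + 1}"
      by blast
    then show "?ys ! p \<le> max (a i) (ord_comp n \<sigma> x (i - 1))"
    proof cases
      case 1
      then have "j \<in> {1..n}" "x (\<sigma> j) \<le> ord_comp n \<sigma> x (i - 1)"
        using i ord_comp_mono[OF x, of j "i - 1"] by (auto simp: ord_comp_def)
      then show ?thesis
        using 1 nth_x by (simp add: max.coboundedI2)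
    next
      case 2
      then have "a (p - n + 1) \<le> a i"
        using i by (intro a) auto
      moreover have "?ys ! p = a (p - n + 1)"
        using 2 sub(2) by (intro nth_a) blast
      ultimately show ?thesis
        by (metis max.coboundedI1)
    qed
  qed
qed

lemma squeeze_values:
  fixes x :: "nat \<Rightarrow> 'a::{linorder, order_bot, order_top}"
  assumes \<sigma>: "\<sigma> permutes {1..n}" and x: "x \<in> chain_simplex n \<sigma>"
    and a: "\<And>i j. 1 \<le> i \<Longrightarrow> i \<le> j \<Longrightarrow> j \<le> n + 1 \<Longrightarrow> a j \<le> a i"
    and y: "squeezed (n + 1) a (ord_comp n \<sigma> x) y"
  shows "y = (MAX i\<in>{1..n+1}. min (a i) (ord_comp n \<sigma> x i))"
    and "y = (MIN i\<in>{1..n+1}. max (a i) (ord_comp n \<sigma> x (i - 1)))"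
    and "y = med (map x [1..<n+1] @ map a [1..<n+2])"
proof -
  have eq: "y = z" if "squeezed (n + 1) a (ord_comp n \<sigma> x) z" for z
    using squeeze_unique[OF _ _ _ y that] by (simp add: ord_comp_def)
  show "y = (MAX i\<in>{1..n+1}. min (a i) (ord_comp n \<sigma> x i))"
    using a ord_comp_mono[OF x] by (intro eq squeezed_Max_Min) auto
  show "y = (MIN i\<in>{1..n+1}. max (a i) (ord_comp n \<sigma> x (i - 1)))"
    using a ord_comp_mono[OF x] by (intro eq squeezed_Max_Min) auto
  show "y = med (map x [1..<n+1] @ map a [1..<n+2])"
    using a by (intro eq squeezed_med[OF \<sigma> x]) auto
qed

section \<open>Polynomial functions are determined on characteristic vectors\<close>

lemma char_vec_in_chain_power: "char_vec n I \<in> chain_power n"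
  by (simp add: char_vec_def chain_power_def)

text \<open>
  In a chain \<open>c \<mapsto> min c s\<close> commutes with joins and meets, so the bound passes through the
  construction of \<open>f\<close>; for a projection it says \<open>s \<le> x i\<close> or \<open>bot \<le> x i\<close>.
\<close>

lemma polynomial_function_ge_threshold:
  assumes "polynomial_function n f" "x \<in> chain_power n" "\<And>j. j \<in> I \<Longrightarrow> s \<le> x j"
  shows "min (alpha n f I) s \<le> f x"
  using assms(1)
  by induction
    (use assms(2,3) char_vec_in_chain_power[of n I] in
      \<open>auto simp: alpha_def char_vec_def min_le_iff_disj le_max_iff_disj\<close>)

text \<open>The order dual: here \<open>c \<mapsto> max c s\<close> commutes with joins and meets.\<close>

lemma polynomial_function_le_threshold:
  assumes "polynomial_function n f" "x \<in> chain_power n" "\<And>j. j \<in> {1..n} - I \<Longrightarrow> x j \<le> s"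
  shows "f x \<le> max (alpha n f I) s"
  using assms(1)
  by induction
    (use assms(2,3) char_vec_in_chain_power[of n I] in
      \<open>auto simp: alpha_def char_vec_def min_le_iff_disj le_max_iff_disj\<close>)

lemma alpha_mono_if_polynomial_function:
  assumes "polynomial_function n f" "I \<subseteq> J" "I \<subseteq> {1..n}"
  shows "alpha n f I \<le> alpha n f J"
proof -
  have "min (alpha n f I) top \<le> f (char_vec n J)"
    using assms(2,3)
    by (intro polynomial_function_ge_threshold assms(1) char_vec_in_chain_power)
      (auto simp: char_vec_def)
  then show ?thesis
    by (simp add: alpha_def)
qed

lemma squeezed_polynomial_function:
  assumes f: "polynomial_function n f"
    and \<sigma>: "\<sigma> permutes {1..n}" and x: "x \<in> chain_simplex n \<sigma>"
  shows "squeezed (n + 1) (\<lambda>i. alpha n f (S_up n \<sigma> i)) (ord_comp n \<sigma> x) (f x)"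
  unfolding squeezed_def
proof (intro ballI conjI)
  fix i assume i: "i \<in> {1..n + 1}"
  have xp: "x \<in> chain_power n"
    using x by (simp add: chain_simplex_def)
  show "min (alpha n f (S_up n \<sigma> i)) (ord_comp n \<sigma> x i) \<le> f x"
  proof (rule polynomial_function_ge_threshold[OF f xp])
    fix p assume "p \<in> S_up n \<sigma> i"
    then obtain j where "j \<in> {i..n}" "p = \<sigma> j"
      by (auto simp: S_up_def)
    then show "ord_comp n \<sigma> x i \<le> x p"
      using i ord_comp_mono[OF x, of i j] by (auto simp: ord_comp_def)
  qed
  show "f x \<le> max (alpha n f (S_up n \<sigma> i)) (ord_comp n \<sigma> x (i - 1))"
  proof (rule polynomial_function_le_threshold[OF f xp])
    fix p assume "p \<in> {1..n} - S_up n \<sigma> i"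
    then have "p \<in> S_down \<sigma> (i - 1)"
      using S_up_eq_Diff_S_down[OF \<sigma>, of i] i by auto
    then obtain j where "j \<in> {1..i - 1}" "p = \<sigma> j"
      by (auto simp: S_down_def)
    then show "x p \<le> ord_comp n \<sigma> x (i - 1)"
      using i ord_comp_mono[OF x, of j "i - 1"] by (auto simp: ord_comp_def)
  qed
qed

section \<open>The join formula forces a disjunctive normal form\<close>

lemma polynomial_function_Min:
  assumes "finite I" "I \<subseteq> {1..n}"
  shows "polynomial_function n (\<lambda>x\<in>chain_power n. Min (insert c (x ` I)))"
  using assms
proof (induction I rule: finite_induct)
  case empty
  then show ?case
    by (simp only: image_empty Min_singleton polynomial_function.const)
next
  case (insert i I)
  have "polynomial_function n (\<lambda>x\<in>chain_power n. min ((\<lambda>x\<in>chain_power n. x i) x)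
      ((\<lambda>x\<in>chain_power n. Min (insert c (x ` I))) x))"
    using insert by (intro polynomial_function.meet polynomial_function.proj) auto
  also have "(\<lambda>x\<in>chain_power n. min ((\<lambda>x\<in>chain_power n. x i) x)
      ((\<lambda>x\<in>chain_power n. Min (insert c (x ` I))) x)) =
      (\<lambda>x\<in>chain_power n. Min (insert c (x ` insert i I)))"
  proof (rule restrict_ext)
    fix x :: "nat \<Rightarrow> 'a" assume "x \<in> chain_power n"
    then show "min ((\<lambda>x\<in>chain_power n. x i) x) ((\<lambda>x\<in>chain_power n. Min (insert c (x ` I))) x) =
        Min (insert c (x ` insert i I))"
      using insert by (simp add: insert_commute[of c])
  qed
  finally show ?case .
qed

lemma polynomial_function_Max:
  assumes "finite A" "A \<noteq> {}"
    and "\<And>a. a \<in> A \<Longrightarrow> polynomial_function n (\<lambda>x\<in>chain_power n. g a x)"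
  shows "polynomial_function n (\<lambda>x\<in>chain_power n. MAX a\<in>A. g a x)"
  using assms
proof (induction A rule: finite_ne_induct)
  case (singleton a)
  then show ?case
    by simp
next
  case (insert a A)
  have "polynomial_function n (\<lambda>x\<in>chain_power n. max ((\<lambda>x\<in>chain_power n. g a x) x)
      ((\<lambda>x\<in>chain_power n. MAX a\<in>A. g a x) x))"
    using insert by (intro polynomial_function.join) auto
  also have "(\<lambda>x\<in>chain_power n. max ((\<lambda>x\<in>chain_power n. g a x) x)
      ((\<lambda>x\<in>chain_power n. MAX a\<in>A. g a x) x)) = (\<lambda>x\<in>chain_power n. MAX a\<in>insert a A. g a x)"
    using insert by (intro restrict_ext) simp
  finally show ?case .
qed

text \<open>
  For \<open>I \<subseteq> J\<close>, list the positions outside \<open>J\<close> first, then those of \<open>J - I\<close>, then those of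
  \<open>I\<close>. With this order \<open>char_vec n J\<close> is sorted and \<open>I\<close> is one of the sets \<open>S_up n \<sigma> i\<close>, so
  \<open>alpha n f I\<close> is one of the joinands of \<open>f (char_vec n J)\<close>.
\<close>

lemma alpha_mono_if_join_formula:
  assumes formula: "\<And>\<sigma> x. \<sigma> permutes {1..n} \<Longrightarrow> x \<in> chain_simplex n \<sigma> \<Longrightarrow>
      f x = (MAX i\<in>{1..n+1}. min (alpha n f (S_up n \<sigma> i)) (ord_comp n \<sigma> x i))"
    and "I \<subseteq> J" "J \<subseteq> {1..n}"
  shows "alpha n f I \<le> alpha n f J"
proof -
  define key :: "nat \<Rightarrow> nat" where
    "key p = (if p \<in> I then 2 else if p \<in> J then 1 else 0)" for p
  obtain \<sigma> where \<sigma>: "\<sigma> permutes {1..n}"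
    and sorted: "\<And>i j. 1 \<le> i \<Longrightarrow> i \<le> j \<Longrightarrow> j \<le> n \<Longrightarrow> key (\<sigma> i) \<le> key (\<sigma> j)"
    by (rule sorting_permutation[of n key]) blast
  have J_up: "\<sigma> j \<in> J" if "1 \<le> i" "i \<le> j" "j \<le> n" "\<sigma> i \<in> J" for i j
    using sorted[OF that(1-3)] that(4) \<open>I \<subseteq> J\<close> by (auto simp: key_def split: if_splits)
  have I_up: "\<sigma> j \<in> I" if "1 \<le> i" "i \<le> j" "j \<le> n" "\<sigma> i \<in> I" for i j
    using sorted[OF that(1-3)] that(4) by (auto simp: key_def split: if_splits)
  have range: "\<sigma> j \<in> {1..n}" if "j \<in> {1..n}" for j
    using permutes_in_image[OF \<sigma>] that by blast
  let ?e = "char_vec n J :: nat \<Rightarrow> 'a"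
  have e: "?e \<in> chain_simplex n \<sigma>"
    unfolding chain_simplex_def
  proof (intro CollectI conjI ballI char_vec_in_chain_power)
    fix i assume "i \<in> {1..<n}"
    then show "?e (\<sigma> i) \<le> ?e (\<sigma> (Suc i))"
      using J_up[of i "Suc i"] range[of i] range[of "Suc i"] by (auto simp: char_vec_def)
  qed
  obtain i where i: "1 \<le> i" "i \<le> n + 1" "I \<subseteq> S_up n \<sigma> i" "i = n + 1 \<or> \<sigma> i \<in> I"
    using first_index_in_set[OF \<sigma>, of I] assms(2,3) by blast
  then have "I = S_up n \<sigma> i"
    using I_up[of i] by (auto simp: S_up_def)
  moreover have "ord_comp n \<sigma> ?e i = top"
    using i assms(2,3) by (auto simp: ord_comp_def char_vec_def)
  ultimately have "alpha n f I = min (alpha n f (S_up n \<sigma> i)) (ord_comp n \<sigma> ?e i)"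
    by simp
  also have "\<dots> \<le> (MAX i\<in>{1..n+1}. min (alpha n f (S_up n \<sigma> i)) (ord_comp n \<sigma> ?e i))"
    using i by (intro Max_ge finite_imageI imageI) auto
  also have "\<dots> = alpha n f J"
    using formula[OF \<sigma> e] by (simp add: alpha_def)
  finally show ?thesis .
qed

text \<open>
  The term of a set \<open>I\<close> in the disjunctive normal form is absorbed by the joinand of the smallest
  \<open>S_up n \<sigma> i\<close> containing \<open>I\<close>: the least component over \<open>I\<close> is the one at \<open>\<sigma> i\<close>, and \<open>alpha n f\<close>
  is monotone. Keeping \<open>alpha n f I\<close> inside the minimum gives the empty set \<open>I\<close> a term, too.
\<close>

lemma polynomial_function_if_join_formula:
  assumes f: "f \<in> chain_power n \<rightarrow>\<^sub>E UNIV"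
    and formula: "\<And>\<sigma> x. \<sigma> permutes {1..n} \<Longrightarrow> x \<in> chain_simplex n \<sigma> \<Longrightarrow>
      f x = (MAX i\<in>{1..n+1}. min (alpha n f (S_up n \<sigma> i)) (ord_comp n \<sigma> x i))"
  shows "polynomial_function n f"
proof -
  let ?term = "\<lambda>I x. Min (insert (alpha n f I) (x ` I))"
  have "f x = (MAX I\<in>Pow {1..n}. ?term I x)" if x: "x \<in> chain_power n" for x
  proof -
    obtain \<sigma> where \<sigma>: "\<sigma> permutes {1..n}"
      and sorted: "\<And>i j. 1 \<le> i \<Longrightarrow> i \<le> j \<Longrightarrow> j \<le> n \<Longrightarrow> x (\<sigma> i) \<le> x (\<sigma> j)"
      by (rule sorting_permutation[of n x]) blast
    then have xs: "x \<in> chain_simplex n \<sigma>"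
      using x by (auto simp: chain_simplex_def)
    let ?R = "MAX i\<in>{1..n+1}. min (alpha n f (S_up n \<sigma> i)) (ord_comp n \<sigma> x i)"
    have "?R = (MAX I\<in>Pow {1..n}. ?term I x)"
    proof (rule antisym)
      show "?R \<le> (MAX I\<in>Pow {1..n}. ?term I x)"
      proof (rule Max.boundedI)
        fix v assume "v \<in> (\<lambda>i. min (alpha n f (S_up n \<sigma> i)) (ord_comp n \<sigma> x i)) ` {1..n + 1}"
        then obtain i where i: "i \<in> {1..n + 1}"
          and v: "v = min (alpha n f (S_up n \<sigma> i)) (ord_comp n \<sigma> x i)"
          by blast
        have sub: "S_up n \<sigma> i \<subseteq> {1..n}"
          using S_up_subset[OF \<sigma>] i by simp
        have "ord_comp n \<sigma> x i \<le> x p" if "p \<in> S_up n \<sigma> i" for p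
          using that i ord_comp_mono[OF xs, of i] by (fastforce simp: S_up_def ord_comp_def)
        then have "v \<le> ?term (S_up n \<sigma> i) x"
          unfolding v using finite_subset[OF sub]
          by (intro Min.boundedI) (auto intro: min.coboundedI2)
        also have "\<dots> \<le> (MAX I\<in>Pow {1..n}. ?term I x)"
          using sub by (intro Max_ge) auto
        finally show "v \<le> (MAX I\<in>Pow {1..n}. ?term I x)" .
      qed auto
      show "(MAX I\<in>Pow {1..n}. ?term I x) \<le> ?R"
      proof (rule Max.boundedI)
        fix v assume "v \<in> (\<lambda>I. ?term I x) ` Pow {1..n}"
        then obtain I where I: "I \<subseteq> {1..n}" and v: "v = ?term I x"
          by blast
        obtain i where i: "1 \<le> i" "i \<le> n + 1" "I \<subseteq> S_up n \<sigma> i" "i = n + 1 \<or> \<sigma> i \<in> I"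
          using first_index_in_set[OF \<sigma> I] by blast
        have fin: "finite I"
          using I finite_subset by blast
        have "v \<le> alpha n f I"
          unfolding v using fin by (intro Min_le) auto
        also have "\<dots> \<le> alpha n f (S_up n \<sigma> i)"
          by (rule alpha_mono_if_join_formula[OF formula i(3) S_up_subset[OF \<sigma> i(1)]])
        finally have "v \<le> alpha n f (S_up n \<sigma> i)" .
        moreover have "v \<le> ord_comp n \<sigma> x i"
        proof (cases "i = n + 1")
          case True
          then show ?thesis
            by (simp add: ord_comp_def)
        next
          case False
          then have "v \<le> x (\<sigma> i)"
            unfolding v using fin i by (intro Min_le) auto
          then show ?thesis
            using False i by (simp add: ord_comp_def)
        qed
        ultimately have "v \<le> min (alpha n f (S_up n \<sigma> i)) (ord_comp n \<sigma> x i)"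
          by simp
        also have "\<dots> \<le> ?R"
          using i by (intro Max_ge finite_imageI imageI) auto
        finally show "v \<le> ?R" .
      qed auto
    qed
    then show ?thesis
      using formula[OF \<sigma> xs] by simp
  qed
  then have "f = (\<lambda>x\<in>chain_power n. MAX I\<in>Pow {1..n}. ?term I x)"
    using f by (intro extensionalityI[of f "chain_power n"]) (auto simp: PiE_iff)
  moreover have "polynomial_function n (\<lambda>x\<in>chain_power n. MAX I\<in>Pow {1..n}. ?term I x)"
    using finite_subset[of _ "{1..n}"]
    by (intro polynomial_function_Max polynomial_function_Min) auto
  ultimately show ?thesis
    by simp
qed

section \<open>The characterisation\<close>

theorem proposition7:
  fixes n :: nat
    and f :: "(nat \<Rightarrow> 'a::{linorder, order_bot, order_top}) \<Rightarrow> 'a"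
  assumes "n \<ge> 1"
    and "f \<in> chain_power n \<rightarrow>\<^sub>E UNIV"
  shows
    "(polynomial_function n f \<longleftrightarrow>
       (\<forall>\<sigma>. \<sigma> permutes {1..n} \<longrightarrow> (\<forall>x\<in>chain_simplex n \<sigma>.
          f x = (MAX i\<in>{1..n+1}. min (alpha n f (S_up n \<sigma> i)) (ord_comp n \<sigma> x i)) \<and>
          f x = (MIN i\<in>{1..n+1}. max (alpha n f (S_up n \<sigma> i)) (ord_comp n \<sigma> x (i - 1))) \<and>
          f x = med (map x [1..<n+1] @ map (\<lambda>i. alpha n f (S_up n \<sigma> i)) [1..<n+2])))) \<and>
     (polynomial_function n f \<longleftrightarrow>
       (\<forall>\<sigma>. \<sigma> permutes {1..n} \<longrightarrow> (\<forall>x\<in>chain_simplex n \<sigma>.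
          f x = (MAX i\<in>{1..n+1}. min (beta n f (S_down \<sigma> (i - 1))) (ord_comp n \<sigma> x i)) \<and>
          f x = (MIN i\<in>{1..n+1}. max (beta n f (S_down \<sigma> (i - 1))) (ord_comp n \<sigma> x (i - 1))) \<and>
          f x = med (map x [1..<n+1] @ map (\<lambda>i. beta n f (S_down \<sigma> i)) [0..<n+1]))))"
proof -
  let ?A = "\<lambda>\<sigma>. \<forall>x\<in>chain_simplex n \<sigma>.
          f x = (MAX i\<in>{1..n+1}. min (alpha n f (S_up n \<sigma> i)) (ord_comp n \<sigma> x i)) \<and>
          f x = (MIN i\<in>{1..n+1}. max (alpha n f (S_up n \<sigma> i)) (ord_comp n \<sigma> x (i - 1))) \<and>
          f x = med (map x [1..<n+1] @ map (\<lambda>i. alpha n f (S_up n \<sigma> i)) [1..<n+2])"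
  let ?B = "\<lambda>\<sigma>. \<forall>x\<in>chain_simplex n \<sigma>.
          f x = (MAX i\<in>{1..n+1}. min (beta n f (S_down \<sigma> (i - 1))) (ord_comp n \<sigma> x i)) \<and>
          f x = (MIN i\<in>{1..n+1}. max (beta n f (S_down \<sigma> (i - 1))) (ord_comp n \<sigma> x (i - 1))) \<and>
          f x = med (map x [1..<n+1] @ map (\<lambda>i. beta n f (S_down \<sigma> i)) [0..<n+1])"
  have "?A \<sigma>" if f: "polynomial_function n f" and \<sigma>: "\<sigma> permutes {1..n}" for \<sigma>
  proof
    fix x :: "nat \<Rightarrow> 'a" assume x: "x \<in> chain_simplex n \<sigma>"
    have anti: "alpha n f (S_up n \<sigma> j) \<le> alpha n f (S_up n \<sigma> i)"
      if "1 \<le> i" "i \<le> j" "j \<le> n + 1" for i j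
    proof (rule alpha_mono_if_polynomial_function[OF f])
      show "S_up n \<sigma> j \<subseteq> S_up n \<sigma> i" "S_up n \<sigma> j \<subseteq> {1..n}"
        using that S_up_subset[OF \<sigma>, of j] by (auto simp: S_up_def)
    qed
    note squeeze_values[OF \<sigma> x anti squeezed_polynomial_function[OF f \<sigma> x]]
    then show "f x = (MAX i\<in>{1..n+1}. min (alpha n f (S_up n \<sigma> i)) (ord_comp n \<sigma> x i)) \<and>
          f x = (MIN i\<in>{1..n+1}. max (alpha n f (S_up n \<sigma> i)) (ord_comp n \<sigma> x (i - 1))) \<and>
          f x = med (map x [1..<n+1] @ map (\<lambda>i. alpha n f (S_up n \<sigma> i)) [1..<n+2])"
      by blast
  qed
  moreover have "polynomial_function n f" if "\<forall>\<sigma>. \<sigma> permutes {1..n} \<longrightarrow> ?A \<sigma>"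
    using that by (intro polynomial_function_if_join_formula[OF assms(2)]) blast
  ultimately have alpha_iff: "polynomial_function n f \<longleftrightarrow> (\<forall>\<sigma>. \<sigma> permutes {1..n} \<longrightarrow> ?A \<sigma>)"
    by blast
  have AB: "?A \<sigma> \<longleftrightarrow> ?B \<sigma>" if \<sigma>: "\<sigma> permutes {1..n}" for \<sigma>
  proof -
    have ab: "alpha n f (S_up n \<sigma> i) = beta n f (S_down \<sigma> (i - 1))" if "i \<in> {1..n + 1}" for i
      using S_up_eq_Diff_S_down[OF \<sigma>, of i] that by (simp add: alpha_def beta_def)
    have "map (\<lambda>i. alpha n f (S_up n \<sigma> i)) [1..<n+2] = map (\<lambda>i. beta n f (S_down \<sigma> i)) [0..<n+1]"
      using ab by (intro nth_equalityI) (auto simp del: upt_Suc)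
    moreover have "(\<lambda>i. min (alpha n f (S_up n \<sigma> i)) (ord_comp n \<sigma> x i)) ` {1..n+1} =
        (\<lambda>i. min (beta n f (S_down \<sigma> (i - 1))) (ord_comp n \<sigma> x i)) ` {1..n+1}"
      and "(\<lambda>i. max (alpha n f (S_up n \<sigma> i)) (ord_comp n \<sigma> x (i - 1))) ` {1..n+1} =
        (\<lambda>i. max (beta n f (S_down \<sigma> (i - 1))) (ord_comp n \<sigma> x (i - 1))) ` {1..n+1}" for x
      using ab by (auto intro!: image_cong)
    ultimately show ?thesis
      by presburger
  qed
  show ?thesis
    using alpha_iff AB by blast
qed

end
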